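(* For every $f\in \mathsf{S}=\bigoplus_{n\ge 1}\mathsf{S}_{2n}$, the polynomial $\overline{\mathsf{e}}_f\in\mathbb{Q}[x_1,x_2,x_3,x_4]$ satisfies the linearized double shuffle relations in depth four, i.e. $\overline{\mathsf{e}}_f\in \mathbb{D}_4$. In particular, $f\mapsto \overline{\mathsf{e}}_f$ is an injective linear map $$\overline{\mathsf{e}}:\mathsf{S}\longrightarrow \mathbb{D}_4 .$$
   Context: Period polynomials. For $n\ge 1$, $\mathsf{S}_{2n}\subset \mathbb{Q}[X,Y]$ is the $\mathbb{Q}$-vector space of homogeneous polynomials $P(X,Y)$ of degree $2n-2$ such that $P(X,Y)+P(Y,X)=0$, $P(\pm X,\pm Y)=P(X,Y)$ (all choices of signs), $P(X,Y)+P(X-Y,X)+P(-Y,X-Y)=0$, and $P(1,0)=0$. Put $\mathsf{S}=\bigoplus_n \mathsf{S}_{2n}$. Exceptional polynomials. Any $f\in \mathsf{S}_{2n}$ vanishes along $x=0$, $y=0$ and $x=y$, so $f(x,y)=xy(x-y)f_0(x,y)$ with $f_0\in\mathbb{Q}[x,y]$; put $f_1(x,y)=(x-y)f_0(x,y)$. Define $$\mathsf{e}_f=\sum_{\mathbb{Z}/5\mathbb{Z}}\Big(f_1(y_4-y_3,y_2-y_1)+(y_0-y_1)f_0(y_2-y_3,y_4-y_3)\Big)\in\mathbb{Q}[y_0,\ldots,y_4],$$ the sum being over the cyclic permutations generated by $(y_0,y_1,y_2,y_3,y_4)\mapsto(y_1,y_2,y_3,y_4,y_0)$. The polynomial $\overline{\mathsf{e}}_f\in\mathbb{Q}[x_1,\ldots,x_4]$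 is obtained from $\mathsf{e}_f$ by setting $y_0=0$ and $y_i=x_i$ for $i=1,\ldots,4$. Extend both linearly to $\mathsf{S}$. Linearized double shuffle relations in depth four. For $f\in\mathbb{Q}[x_1,\ldots,x_4]$ and $\{i,j,k,l\}=\{1,2,3,4\}$ write $f(ijkl)=f(x_i,x_j,x_k,x_l)$ and $f^{\sharp}(ijkl)=f(x_i,\,x_i+x_j,\,x_i+x_j+x_k,\,x_i+x_j+x_k+x_l)$, and extend linearly to formal linear combinations of the symbols $ijkl$. Let $A=1234+2134+2314+2341$ (the shuffle of $1$ with $234$) and $B=1234+1324+1342+3124+3142+3412$ (the shuffle of $12$ with $34$). Then $\mathbb{D}_4$ is the space of $f\in\mathbb{Q}[x_1,\ldots,x_4]$ with $f(A)=0$, $f(B)=0$, $f^{\sharp}(A)=0$, $f^{\sharp}(B)=0$. *)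

theory Defs
  imports Complex_Main "HOL-Library.Poly_Mapping"
begin

text \<open>
  Polynomials over the rationals in variables indexed by \<^typ>\<open>nat\<close>: finitely supported maps from
  monomials (finitely supported exponent vectors) to coefficients, with the convolution product of
  \<^theory>\<open>HOL-Library.Poly_Mapping\<close>. The rings \<open>\<rat>[X,Y]\<close>, \<open>\<rat>[y\<^sub>0,\<dots>,y\<^sub>4]\<close> and \<open>\<rat>[x\<^sub>1,\<dots>,x\<^sub>4]\<close>
  are the subrings \<open>poly_ring {0,1}\<close>, \<open>poly_ring {0..4}\<close> and \<open>poly_ring {1..4}\<close>.
\<close>

type_synonym qpoly = "(nat \<Rightarrow>\<^sub>0 nat) \<Rightarrow>\<^sub>0 rat"

definition Const :: "rat \<Rightarrow> qpoly" where
  "Const c = Poly_Mapping.single 0 c"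

definition Var :: "nat \<Rightarrow> qpoly" where
  "Var i = Poly_Mapping.single (Poly_Mapping.single i 1) 1"

definition scale :: "rat \<Rightarrow> qpoly \<Rightarrow> qpoly" where
  "scale c p = Const c * p"

definition poly_ring :: "nat set \<Rightarrow> qpoly set" where
  "poly_ring I = {p. \<forall>m \<in> Poly_Mapping.keys p. Poly_Mapping.keys m \<subseteq> I}"

definition homogeneous :: "nat \<Rightarrow> qpoly \<Rightarrow> bool" where
  "homogeneous d p \<longleftrightarrow>
     (\<forall>m \<in> Poly_Mapping.keys p. (\<Sum>i \<in> Poly_Mapping.keys m. Poly_Mapping.lookup m i) = d)"

definition subst :: "(nat \<Rightarrow> qpoly) \<Rightarrow> qpoly \<Rightarrow> qpoly" where
  "subst \<sigma> p = (\<Sum>m \<in> Poly_Mapping.keys p.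
     Const (Poly_Mapping.lookup p m) * (\<Prod>i \<in> Poly_Mapping.keys m. \<sigma> i ^ Poly_Mapping.lookup m i))"

text \<open>The vector space notions \<open>qvs.subspace\<close>, \<open>qvs.span\<close> and so on, over the rationals.\<close>

interpretation qvs: vector_space scale
  by unfold_locales
     (simp_all add: scale_def Const_def algebra_simps single_add mult_single flip: mult.assoc)


subsection \<open>Period polynomials\<close>

abbreviation X :: qpoly where "X \<equiv> Var 0"
abbreviation Y :: qpoly where "Y \<equiv> Var 1"

text \<open>\<open>ev2 P a b\<close> is \<open>P(a,b)\<close>, meant for \<open>P\<close> in \<open>poly_ring {0,1}\<close>.\<close>

definition ev2 :: "qpoly \<Rightarrow> qpoly \<Rightarrow> qpoly \<Rightarrow> qpoly" where
  "ev2 P a b = subst ((\<lambda>_. 0)(0 := a, 1 := b)) P"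

definition S2 :: "nat \<Rightarrow> qpoly set" where
  "S2 n = {P \<in> poly_ring {0,1}.
      homogeneous (2 * n - 2) P \<and>
      P + ev2 P Y X = 0 \<and>
      (\<forall>s \<in> {1, -1}. \<forall>t \<in> {1, -1}. ev2 P (s * X) (t * Y) = P) \<and>
      P + ev2 P (X - Y) X + ev2 P (- Y) (X - Y) = 0 \<and>
      ev2 P 1 0 = 0}"

text \<open>
  The direct sum of the \<open>S2 n\<close>, formed inside \<open>\<rat>[X,Y]\<close>: the summands are homogeneous of different
  degrees, so their sum there is direct.
\<close>

definition S :: "qpoly set" where
  "S = {\<Sum>n\<in>N. P n | N P. finite N \<and> N \<subseteq> {1..} \<and> (\<forall>n\<in>N. P n \<in> S2 n)}"


subsection \<open>Exceptional polynomials\<close>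

text \<open>
  The quotient of \<open>f\<close> by \<open>xy(x - y)\<close>, used only for \<open>f\<close> in \<open>S\<close>. The division makes sense for all
  of \<open>S\<close>, not only for homogeneous elements, and is linear there; so the formula for \<open>exc f\<close> below,
  read on \<open>S\<close>, is the linear extension of its restrictions to the \<open>S2 n\<close>.
\<close>

definition f0 :: "qpoly \<Rightarrow> qpoly" where
  "f0 f = (THE g. g \<in> poly_ring {0,1} \<and> f = X * Y * (X - Y) * g)"

definition f1 :: "qpoly \<Rightarrow> qpoly" where
  "f1 f = (X - Y) * f0 f"

lemma X_nonzero: "X \<noteq> 0" and Y_nonzero: "Y \<noteq> 0" and X_minus_Y_nonzero: "X - Y \<noteq> 0"
proof -
  have "Poly_Mapping.lookup (Var i) (Poly_Mapping.single i 1) = 1" for i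
    by (simp add: Var_def)
  then show "X \<noteq> 0" "Y \<noteq> 0"
    by (metis lookup_zero zero_neq_one)+
  have "Poly_Mapping.single (0::nat) (1::nat) \<noteq> Poly_Mapping.single 1 1"
    by (metis lookup_single_eq lookup_single_not_eq zero_neq_one)
  then have "Poly_Mapping.lookup (X - Y) (Poly_Mapping.single 0 1) = 1"
    by (simp add: Var_def lookup_minus lookup_single when_def)
  then show "X - Y \<noteq> 0"
    by (metis lookup_zero zero_neq_one)
qed

lemma f0_eqI:
  assumes "g \<in> poly_ring {0,1}" and "f = X * Y * (X - Y) * g"
  shows "f0 f = g"
  unfolding f0_def
proof (rule the_equality)
  show "h = g" if "h \<in> poly_ring {0,1} \<and> f = X * Y * (X - Y) * h" for h
  proof -
    have "X * Y * (X - Y) * h = X * Y * (X - Y) * g"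
      using that assms(2) by metis
    moreover have "X * Y * (X - Y) \<noteq> 0"
      using X_nonzero Y_nonzero X_minus_Y_nonzero by simp
    ultimately show ?thesis
      by (metis mult_left_cancel)
  qed
qed (use assms in simp)

definition exc :: "qpoly \<Rightarrow> qpoly" where
  "exc f = (\<Sum>i<5. let y = (\<lambda>k. Var ((k + i) mod 5)) in
      ev2 (f1 f) (y 4 - y 3) (y 2 - y 1) + (y 0 - y 1) * ev2 (f0 f) (y 2 - y 3) (y 4 - y 3))"

text \<open>Both \<open>y\<^sub>i\<close> and \<open>x\<^sub>i\<close> are \<open>Var i\<close>, so passing to \<open>\<rat>[x\<^sub>1,\<dots>,x\<^sub>4]\<close> only sets \<open>Var 0\<close> to zero.\<close>

definition exc_bar :: "qpoly \<Rightarrow> qpoly" where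
  "exc_bar f = subst (Var(0 := 0)) (exc f)"


subsection \<open>Linearized double shuffle relations in depth four\<close>

definition ev4 :: "qpoly \<Rightarrow> qpoly \<Rightarrow> qpoly \<Rightarrow> qpoly \<Rightarrow> qpoly \<Rightarrow> qpoly" where
  "ev4 f a b c d = subst ((\<lambda>_. 0)(1 := a, 2 := b, 3 := c, 4 := d)) f"

type_synonym symbol = "nat \<times> nat \<times> nat \<times> nat"

fun word :: "qpoly \<Rightarrow> symbol \<Rightarrow> qpoly" where
  "word f (i, j, k, l) = ev4 f (Var i) (Var j) (Var k) (Var l)"

fun word_sharp :: "qpoly \<Rightarrow> symbol \<Rightarrow> qpoly" where
  "word_sharp f (i, j, k, l) =
     ev4 f (Var i) (Var i + Var j) (Var i + Var j + Var k) (Var i + Var j + Var k + Var l)"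

text \<open>Each shuffle is a formal sum of distinct symbols with coefficient 1, given by its support.\<close>

definition shA :: "symbol set" where
  "shA = {(1,2,3,4), (2,1,3,4), (2,3,1,4), (2,3,4,1)}"

definition shB :: "symbol set" where
  "shB = {(1,2,3,4), (1,3,2,4), (1,3,4,2), (3,1,2,4), (3,1,4,2), (3,4,1,2)}"

definition D4 :: "qpoly set" where
  "D4 = {f \<in> poly_ring {1..4}.
      (\<Sum>w\<in>shA. word f w) = 0 \<and> (\<Sum>w\<in>shB. word f w) = 0 \<and>
      (\<Sum>w\<in>shA. word_sharp f w) = 0 \<and> (\<Sum>w\<in>shB. word_sharp f w) = 0}"

end

theory Submission
  imports Defs
begin

text \<open>
  Write \<open>f = x y (x - y) f\<^sub>0\<close>. The relations of a period polynomial say that \<open>f\<^sub>0\<close> is symmetric and odd,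
  that \<open>f\<^sub>1 = (x - y) f\<^sub>0\<close> is odd in each variable, and that
  \<open>f\<^sub>0(x,y) - f\<^sub>0(x-y,x) + f\<^sub>0(-y,x-y) = 0\<close>. The locale \<open>period_function\<close> isolates these properties;
  the double shuffle relations follow from them alone.

  The polynomial \<open>e\<^sub>f\<close> is a sum over the pairs of edges of the pentagon with vertices \<open>y\<^sub>0\<close>, ...,
  \<open>y\<^sub>4\<close>: two disjoint edges contribute a value of \<open>f\<^sub>1\<close>, two adjacent edges contribute a value of
  \<open>f\<^sub>0\<close> weighted by the edge opposite to their common vertex. A shuffle relation adds such sums over
  several orderings of the same five points. In \<open>pentagon_shuffle_1_3\<close> and \<open>pentagon_shuffle_2_2\<close> the
  contributions of disjoint edges cancel in pairs, because \<open>f\<^sub>1\<close> changes sign when an edge is reversed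
  or the edges are exchanged. The contributions of adjacent edges group into triangles. The
  three-term relation, read at differences of points, says that the three angles of a triangle
  contribute zero (\<open>triangle\<close>).

  In the \<open>\<sharp>\<close>-relations it is the edges \<open>d\<^sub>i = y\<^sub>i\<^sub>+\<^sub>1 - y\<^sub>i\<close> of the pentagon, no longer its vertices,
  that are shuffled. Since \<open>f\<^sub>1(u,v) = (u + v) f\<^sub>0(-u,v)\<close>, each contribution is a linear form times a
  value of the antisymmetric function \<open>f\<^sub>0(-u,v)\<close> at a pair of edges. For each pair the linear forms add
  up to zero or to \<open>\<plusminus>(d\<^sub>0 + ... + d\<^sub>4)\<close>, and the edges of a pentagon add up to zero
  (\<open>pentagon_sharp_shuffle_1_3\<close>, \<open>pentagon_sharp_shuffle_2_2\<close>).

  For injectivity, a degenerate pentagon in which two edges have length zero leaves a single term,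
  the value of \<open>f\<^sub>1\<close> at two independent variables (\<open>pentagon_degenerate\<close>). So \<open>f\<close> can be read off
  from \<open>e\<^sub>f\<close>.
\<close>

(* The variables of index 1 and the assignments at 1 have to keep matching literally. *)
declare One_nat_def [simp del]

section \<open>Substitution as a ring homomorphism\<close>

definition monomial_value :: "(nat \<Rightarrow> qpoly) \<Rightarrow> (nat \<Rightarrow>\<^sub>0 nat) \<Rightarrow> qpoly" where
  "monomial_value \<sigma> m = (\<Prod>i \<in> Poly_Mapping.keys m. \<sigma> i ^ Poly_Mapping.lookup m i)"

lemma monomial_value_superset:
  assumes "finite A" "Poly_Mapping.keys m \<subseteq> A"
  shows "monomial_value \<sigma> m = (\<Prod>i \<in> A. \<sigma> i ^ Poly_Mapping.lookup m i)"
  unfolding monomial_value_def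
  by (rule prod.mono_neutral_left) (use assms in \<open>auto simp: in_keys_iff\<close>)

lemma monomial_value_zero [simp]: "monomial_value \<sigma> 0 = 1"
  by (simp add: monomial_value_def)

lemma monomial_value_add: "monomial_value \<sigma> (m + n) = monomial_value \<sigma> m * monomial_value \<sigma> n"
proof -
  let ?A = "Poly_Mapping.keys m \<union> Poly_Mapping.keys n"
  have "finite ?A" "Poly_Mapping.keys (m + n) \<subseteq> ?A"
    by (auto dest: subsetD[OF keys_add])
  then show ?thesis
    by (simp add: monomial_value_superset[of ?A] lookup_add power_add prod.distrib)
qed

text \<open>
  A monomial evaluated at the variables is that monomial. Hence substituting the variables is the
  identity (\<open>subst_Var_eq\<close>).
\<close>

lemma monomial_value_Var: "monomial_value Var m = Poly_Mapping.single m 1"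
proof -
  have power: "Var i ^ k = Poly_Mapping.single (Poly_Mapping.single i k) 1" for i k
    by (induction k) (simp_all add: Var_def mult_single One_nat_def flip: single_add)
  have "(\<Prod>i\<in>A. Poly_Mapping.single (h i) (1::rat)) = Poly_Mapping.single (\<Sum>i\<in>A. h i) 1"
    if "finite A" for A and h :: "nat \<Rightarrow> nat \<Rightarrow>\<^sub>0 nat"
    using that by induction (simp_all add: mult_single)
  moreover have "(\<Sum>i\<in>Poly_Mapping.keys m. Poly_Mapping.single i (Poly_Mapping.lookup m i)) = m"
    by (rule poly_mapping_eqI)
      (auto simp: lookup_sum lookup_single when_def in_keys_iff)
  ultimately show ?thesis
    by (simp add: monomial_value_def power)
qed

lemma Const_add: "Const (a + b) = Const a + Const b"
  by (simp add: Const_def single_add)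

lemma Const_mult: "Const (a * b) = Const a * Const b"
  by (simp add: Const_def mult_single)

lemma Const_zero [simp]: "Const 0 = 0" and Const_one [simp]: "Const 1 = 1"
  by (simp_all add: Const_def)

lemma subst_superset:
  assumes "finite A" "Poly_Mapping.keys p \<subseteq> A"
  shows "subst \<sigma> p = (\<Sum>m\<in>A. Const (Poly_Mapping.lookup p m) * monomial_value \<sigma> m)"
  unfolding subst_def monomial_value_def
  by (rule sum.mono_neutral_left) (use assms in \<open>auto simp: in_keys_iff\<close>)

lemma subst_zero [simp]: "subst \<sigma> 0 = 0"
  by (simp add: subst_def)

lemma subst_single: "subst \<sigma> (Poly_Mapping.single m c) = Const c * monomial_value \<sigma> m"
  by (subst subst_superset[of "{m}"]) auto

lemma subst_Const [simp]: "subst \<sigma> (Const c) = Const c"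
  by (simp add: Const_def subst_single)

lemma subst_Var [simp]: "subst \<sigma> (Var i) = \<sigma> i"
  by (simp add: Var_def subst_single monomial_value_def)

lemma subst_add [simp]: "subst \<sigma> (p + q) = subst \<sigma> p + subst \<sigma> q"
proof -
  let ?A = "Poly_Mapping.keys p \<union> Poly_Mapping.keys q"
  have "finite ?A" "Poly_Mapping.keys (p + q) \<subseteq> ?A"
    by (auto dest: subsetD[OF keys_add])
  then show ?thesis
    by (simp add: subst_superset[of ?A] lookup_add Const_add algebra_simps sum.distrib)
qed

lemma subst_sum [simp]: "subst \<sigma> (\<Sum>i\<in>A. p i) = (\<Sum>i\<in>A. subst \<sigma> (p i))"
  by (induction A rule: infinite_finite_induct) simp_all

lemma subst_Var_eq: "subst Var p = p"
proof (rule poly_mapping_eqI)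
  fix k
  have "Poly_Mapping.lookup (subst Var p) k =
      (\<Sum>m\<in>Poly_Mapping.keys p. Poly_Mapping.lookup p m when m = k)"
    by (simp add: subst_superset[OF finite_keys subset_refl] monomial_value_Var Const_def
        mult_single lookup_sum lookup_single)
  also have "\<dots> = Poly_Mapping.lookup p k"
    by (auto simp: when_def in_keys_iff)
  finally show "Poly_Mapping.lookup (subst Var p) k = Poly_Mapping.lookup p k" .
qed

lemma sum_monomials:
  fixes p :: qpoly
  shows "p = (\<Sum>m\<in>Poly_Mapping.keys p. Poly_Mapping.single m (Poly_Mapping.lookup p m))"
  using subst_Var_eq[of p]
  by (simp add: subst_superset[OF finite_keys subset_refl] monomial_value_Var Const_def mult_single)

lemma subst_mult [simp]: "subst \<sigma> (p * q) = subst \<sigma> p * subst \<sigma> q"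
proof -
  have "p * q = (\<Sum>m\<in>Poly_Mapping.keys p. \<Sum>n\<in>Poly_Mapping.keys q.
      Poly_Mapping.single (m + n) (Poly_Mapping.lookup p m * Poly_Mapping.lookup q n))"
    using arg_cong2[OF sum_monomials[of p] sum_monomials[of q], of "(*)"]
    by (simp only: sum_product mult_single)
  then have "subst \<sigma> (p * q) = (\<Sum>m\<in>Poly_Mapping.keys p. \<Sum>n\<in>Poly_Mapping.keys q.
      Const (Poly_Mapping.lookup p m * Poly_Mapping.lookup q n) * monomial_value \<sigma> (m + n))"
    by (simp add: subst_single)
  also have "\<dots> = subst \<sigma> p * subst \<sigma> q"
    by (simp add: Const_mult monomial_value_add sum_product mult_ac
        subst_superset[OF finite_keys subset_refl])
  finally show ?thesis .
qed

lemma subst_uminus [simp]: "subst \<sigma> (- p) = - subst \<sigma> p"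
  by (rule minus_unique[symmetric]) (simp flip: subst_add)

lemma subst_diff [simp]: "subst \<sigma> (p - q) = subst \<sigma> p - subst \<sigma> q"
  using subst_add[of \<sigma> p "- q"] by simp


section \<open>Subrings of polynomials in fewer variables\<close>

lemma poly_ring_Const [simp]: "Const c \<in> poly_ring I"
  by (simp add: poly_ring_def Const_def)

lemma poly_ring_zero [simp]: "0 \<in> poly_ring I"
  by (simp add: poly_ring_def)

lemma poly_ring_Var: "i \<in> I \<Longrightarrow> Var i \<in> poly_ring I"
  by (simp add: poly_ring_def Var_def)

lemma poly_ring_add: "p \<in> poly_ring I \<Longrightarrow> q \<in> poly_ring I \<Longrightarrow> p + q \<in> poly_ring I"
  unfolding poly_ring_def using keys_add[of p q] by blast

lemma poly_ring_mult: "p \<in> poly_ring I \<Longrightarrow> q \<in> poly_ring I \<Longrightarrow> p * q \<in> poly_ring I"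
  unfolding poly_ring_def mem_Collect_eq
proof
  fix m
  assume *: "\<forall>m\<in>Poly_Mapping.keys p. Poly_Mapping.keys m \<subseteq> I"
    "\<forall>m\<in>Poly_Mapping.keys q. Poly_Mapping.keys m \<subseteq> I"
    and "m \<in> Poly_Mapping.keys (p * q)"
  then obtain a b where "a \<in> Poly_Mapping.keys p" "b \<in> Poly_Mapping.keys q" "m = a + b"
    using keys_mult[of p q] by blast
  then show "Poly_Mapping.keys m \<subseteq> I"
    using * keys_add[of a b] by blast
qed

lemma poly_ring_uminus: "p \<in> poly_ring I \<Longrightarrow> - p \<in> poly_ring I"
  by (simp add: poly_ring_def in_keys_iff)

lemma poly_ring_diff: "p \<in> poly_ring I \<Longrightarrow> q \<in> poly_ring I \<Longrightarrow> p - q \<in> poly_ring I"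
  using poly_ring_add[of p I "- q"] poly_ring_uminus by simp

text \<open>
  Evaluating a polynomial at the variables rebuilds it from constants and from the variables that
  occur in its monomials.
\<close>

lemma poly_ring_induct [consumes 1, case_names Const Var add mult]:
  assumes p: "p \<in> poly_ring I"
    and Const: "\<And>c. Q (Const c)"
    and Var: "\<And>i. i \<in> I \<Longrightarrow> Q (Var i)"
    and add: "\<And>p q. Q p \<Longrightarrow> Q q \<Longrightarrow> Q (p + q)"
    and mult: "\<And>p q. Q p \<Longrightarrow> Q q \<Longrightarrow> Q (p * q)"
  shows "Q p"
proof -
  have Q0: "Q 0" and Q1: "Q 1"
    using Const[of 0] Const[of 1] by simp_all
  have power: "Q (a ^ k)" if "Q a" for a and k :: nat
    by (induction k) (simp_all add: Q1 mult that)
  have prod: "Q (\<Prod>i\<in>A. h i)" if "\<And>i. i \<in> A \<Longrightarrow> Q (h i)" for A and h :: "nat \<Rightarrow> qpoly"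
    using that by (induction A rule: infinite_finite_induct) (simp_all add: Q1 mult)
  have sum: "Q (\<Sum>i\<in>A. h i)" if "\<And>i. i \<in> A \<Longrightarrow> Q (h i)" for A and h :: "(nat \<Rightarrow>\<^sub>0 nat) \<Rightarrow> qpoly"
    using that by (induction A rule: infinite_finite_induct) (simp_all add: Q0 add)
  have "Q (subst Var p)"
    unfolding subst_def using p
    by (intro sum mult Const prod power Var) (auto simp: poly_ring_def)
  then show ?thesis
    by (simp add: subst_Var_eq)
qed

lemma poly_ring_UNIV: "p \<in> poly_ring UNIV"
  by (simp add: poly_ring_def)

lemma subst_subst: "subst \<tau> (subst \<sigma> p) = subst (\<lambda>i. subst \<tau> (\<sigma> i)) p"
  using poly_ring_UNIV[of p] by (induction rule: poly_ring_induct) simp_all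

lemma subst_cong:
  assumes "p \<in> poly_ring I" "\<And>i. i \<in> I \<Longrightarrow> \<sigma> i = \<tau> i"
  shows "subst \<sigma> p = subst \<tau> p"
  using assms by (induction rule: poly_ring_induct) simp_all

lemma subst_in_poly_ring:
  assumes "p \<in> poly_ring I" "\<And>i. i \<in> I \<Longrightarrow> \<sigma> i \<in> poly_ring J"
  shows "subst \<sigma> p \<in> poly_ring J"
  using assms by (induction rule: poly_ring_induct) (simp_all add: poly_ring_add poly_ring_mult)

text \<open>
  Substitutions congruent modulo \<open>d\<close> give congruent results. This is what replaces polynomial
  division: a linear form divides \<open>p\<close> as soon as \<open>p\<close> vanishes after a substitution that is the
  identity modulo this form.
\<close>

lemma dvd_subst_diff:
  assumes "\<And>i. d dvd \<sigma> i - \<tau> i"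
  shows "d dvd subst \<sigma> p - subst \<tau> p"
  using poly_ring_UNIV[of p]
proof (induction rule: poly_ring_induct)
  case (add p q)
  then have "d dvd (subst \<sigma> p - subst \<tau> p) + (subst \<sigma> q - subst \<tau> q)"
    by (rule dvd_add)
  then show ?case
    by (simp add: algebra_simps)
next
  case (mult p q)
  then have "d dvd (subst \<sigma> p - subst \<tau> p) * subst \<sigma> q + subst \<tau> p * (subst \<sigma> q - subst \<tau> q)"
    by (simp add: dvd_add)
  then show ?case
    by (simp add: algebra_simps)
qed (simp_all add: assms)


section \<open>Two-variable evaluation\<close>

lemma ev2_zero [simp]: "ev2 0 a b = 0"
  and ev2_add: "ev2 (p + q) a b = ev2 p a b + ev2 q a b"
  and ev2_diff: "ev2 (p - q) a b = ev2 p a b - ev2 q a b"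
  and ev2_uminus: "ev2 (- p) a b = - ev2 p a b"
  and ev2_mult: "ev2 (p * q) a b = ev2 p a b * ev2 q a b"
  and ev2_X [simp]: "ev2 X a b = a"
  and ev2_Y [simp]: "ev2 Y a b = b"
  and ev2_Const [simp]: "ev2 (Const c) a b = Const c"
  by (simp_all add: ev2_def)

lemmas ev2_ring = ev2_add ev2_diff ev2_uminus ev2_mult

lemma subst_ev2: "subst \<sigma> (ev2 p a b) = ev2 p (subst \<sigma> a) (subst \<sigma> b)"
  unfolding ev2_def subst_subst by (rule subst_cong[OF poly_ring_UNIV]) auto

lemma ev2_ev2: "ev2 (ev2 p a b) c d = ev2 p (ev2 a c d) (ev2 b c d)"
  by (metis ev2_def subst_ev2)

lemma ev2_X_Y: "p \<in> poly_ring {0,1} \<Longrightarrow> ev2 p X Y = p"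
  unfolding ev2_def by (subst subst_cong[of p "{0,1}" _ Var]) (auto simp: subst_Var_eq)

lemma ev2_in_poly_ring: "a \<in> poly_ring J \<Longrightarrow> b \<in> poly_ring J \<Longrightarrow> ev2 p a b \<in> poly_ring J"
  unfolding ev2_def by (rule subst_in_poly_ring[OF poly_ring_UNIV]) simp

lemma dvd_ev2_diff:
  assumes "d dvd a - a'" "d dvd b - b'"
  shows "d dvd ev2 p a b - ev2 p a' b'"
  unfolding ev2_def by (rule dvd_subst_diff) (simp add: assms)

text \<open>
  The factor theorem for a line with parametrization \<open>(a, b)\<close>. The cofactor found by divisibility may
  involve foreign variables; setting them to zero does not affect the equation, as \<open>p\<close> and \<open>l\<close> are
  free of them.
\<close>

lemma linear_factor:
  assumes p: "p \<in> poly_ring {0,1}" and l: "l \<in> poly_ring {0,1}"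
    and root: "ev2 p a b = 0" "l dvd X - a" "l dvd Y - b"
  obtains q where "q \<in> poly_ring {0,1}" "p = l * q"
proof -
  have "l dvd p"
    using dvd_ev2_diff[OF root(2,3), of p] root(1) ev2_X_Y[OF p] by simp
  then obtain q where "p = l * q" ..
  then have "p = l * ev2 q X Y"
    using ev2_X_Y[OF p] ev2_X_Y[OF l] by (metis ev2_mult)
  moreover have "ev2 q X Y \<in> poly_ring {0,1}"
    by (simp add: ev2_in_poly_ring poly_ring_Var)
  ultimately show ?thesis
    using that by blast
qed


section \<open>The pentagon sum of a period function\<close>

text \<open>
  With \<open>g\<close> the evaluation of \<open>f0 f\<close>, the cell is the summand of \<open>exc f\<close>. For a pentagon with vertices
  \<open>a\<close>, \<open>b\<close>, \<open>c\<close>, \<open>d\<close>, \<open>e\<close> its first term is attached to the two disjoint edges \<open>de\<close> and \<open>bc\<close>, and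
  its second term to the angle \<open>cde\<close>, weighted by the opposite edge \<open>ab\<close>. The five rotations run
  through all pairs of edges.
\<close>

definition pentagon_cell :: "('a::idom \<Rightarrow> 'a \<Rightarrow> 'a) \<Rightarrow> 'a \<Rightarrow> 'a \<Rightarrow> 'a \<Rightarrow> 'a \<Rightarrow> 'a \<Rightarrow> 'a" where
  "pentagon_cell g a b c d e =
     ((e - d) - (c - b)) * g (e - d) (c - b) + (a - b) * g (c - d) (e - d)"

definition pentagon :: "('a::idom \<Rightarrow> 'a \<Rightarrow> 'a) \<Rightarrow> 'a \<Rightarrow> 'a \<Rightarrow> 'a \<Rightarrow> 'a \<Rightarrow> 'a \<Rightarrow> 'a" where
  "pentagon g a b c d e = pentagon_cell g a b c d e + pentagon_cell g b c d e a
     + pentagon_cell g c d e a b + pentagon_cell g d e a b c + pentagon_cell g e a b c d"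

text \<open>
  What the relations of a period polynomial \<open>f\<close> become for \<open>g(u,v) = f(u,v) / (u v (u - v))\<close>.
  The antisymmetry of \<open>f\<close> makes \<open>g\<close> symmetric, the invariance under signs gives \<open>odd\<close> and
  \<open>reflection\<close>. In the three-term relation of \<open>f\<close> the denominators of the three terms agree up to
  sign, so that it turns into \<open>period\<close>.
\<close>

locale period_function =
  fixes g :: "'a::{idom,ring_char_0} \<Rightarrow> 'a \<Rightarrow> 'a"
  assumes symmetric: "g v u = g u v"
    and odd: "g (- u) (- v) = - g u v"
    and reflection: "(u + v) * g (- u) v = (u - v) * g u v"
    and period: "g u v - g (u - v) u + g (- v) (u - v) = 0"
begin

text \<open>The counterpart of \<open>f1\<close>: it equals \<open>f(u,v) / (u v)\<close>, hence it is odd in each variable.\<close>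

definition h :: "'a \<Rightarrow> 'a \<Rightarrow> 'a" where
  "h u v = (u - v) * g u v"

lemma h_swap: "h v u = - h u v"
  by (simp add: h_def symmetric[of v u] algebra_simps)

lemma h_minus_left: "h (- u) v = - h u v"
proof -
  have "h (- u) v = - ((u + v) * g (- u) v)"
    by (simp add: h_def algebra_simps)
  then show ?thesis
    by (simp only: reflection h_def)
qed

lemma h_minus_right: "h u (- v) = - h u v"
  using h_minus_left[of v u] h_swap by metis

text \<open>
  The period relation at \<open>u = a - b\<close>, \<open>v = c - b\<close>: the values of \<open>g\<close> at the three angles of a triangle
  add up to zero.
\<close>

lemma triangle: "g (a - b) (c - b) + g (b - c) (a - c) + g (c - a) (b - a) = 0"
proof -
  have "g (c - a) (b - a) = - g (a - c) (a - b)"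
    using odd[of "a - c" "a - b"] by simp
  then show ?thesis
    using period[of "a - b" "c - b"] by (simp add: algebra_simps)
qed

text \<open>
  Collect the terms of a shuffle sum by the edges between the five points \<open>y 0\<close>, ..., \<open>y 4\<close>.
  Each pair of disjoint edges occurs with total coefficient zero once the signs of \<open>h\<close> are taken into
  account, and the three angles of each triangle occur with one common weight, so that they cancel by
  \<open>triangle\<close>.
\<close>

lemma
  fixes y :: "nat \<Rightarrow> 'a"
  defines "p \<equiv> \<lambda>i j k l. pentagon g (y 0) (y i) (y j) (y k) (y l)"
  shows pentagon_shuffle_1_3: "p 1 2 3 4 + p 2 1 3 4 + p 2 3 1 4 + p 2 3 4 1 = 0"
    and pentagon_shuffle_2_2:
      "p 1 2 3 4 + p 1 3 2 4 + p 1 3 4 2 + p 3 1 2 4 + p 3 1 4 2 + p 3 4 1 2 = 0"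
proof -
  (* Indexing by numerals instead of points lets the sign rules be oriented by the order of the
     indices; the rewriting then reaches a normal form. *)
  define H where "H i j k l = h (y i - y j) (y k - y l)" for i j k l
  define T where "T i j k = g (y i - y j) (y k - y j)" for i j k
  have cell: "pentagon_cell g (y i) (y j) (y k) (y l) (y m)
      = H m l k j + (y i - y j) * T k l m" for i j k l m
    by (simp add: pentagon_cell_def H_def T_def h_def)
  have H_left: "H i j k l = - H j i k l" if "j < i" for i j k l
    using h_minus_left[of "y j - y i"] by (simp add: H_def)
  have H_right: "H i j k l = - H i j l k" if "l < k" for i j k l
    using h_minus_right[of _ "y l - y k"] by (simp add: H_def)
  have H_swap: "H i j k l = - H k l i j" if "k < i" for i j k l
    by (simp add: H_def h_swap[of "y i - y j"])
  have T_swap: "T i j k = T k j i" for i j k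
    by (simp add: T_def symmetric[of "y i - y j"])
  (* Eliminates, in every triangle, the angle at the vertex of smallest index. *)
  have T_triangle: "T i j k = - T j i k - T j k i" if "j < i" "j < k" for i j k
  proof -
    have "T i j k + T j k i + T k i j = 0"
      unfolding T_def by (rule triangle)
    then have "T i j k = - T k i j - T j k i"
      by algebra
    then show ?thesis
      using T_swap[of j k i] T_swap[of k i j] by simp
  qed
  note rules = p_def pentagon_def cell H_left H_right H_swap T_swap T_triangle
  show "p 1 2 3 4 + p 2 1 3 4 + p 2 3 1 4 + p 2 3 4 1 = 0"
    by (simp add: rules) (simp add: algebra_simps)
  show "p 1 2 3 4 + p 1 3 2 4 + p 1 3 4 2 + p 3 1 2 4 + p 3 1 4 2 + p 3 4 1 2 = 0"
    by (simp add: rules) (simp add: algebra_simps)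
qed

text \<open>
  The arguments of the \<open>\<sharp>\<close>-relations are partial sums, so the pentagon has edges \<open>x i\<close>, \<open>x j\<close>, \<open>x k\<close>,
  \<open>x l\<close> and a fifth edge, minus their sum, that closes it. The function \<open>G(u,v) = - g (- u) v\<close> is
  antisymmetric by \<open>odd\<close> and \<open>symmetric\<close>, and \<open>h u v = - (u + v) G(u,v)\<close> by \<open>reflection\<close>; so both
  kinds of terms are multiples of values of \<open>G\<close> at pairs of edges. Over a shuffle the coefficient of
  each such value sums to zero or, up to sign, to the sum of all five edges, which vanishes.
\<close>

lemma
  fixes x :: "nat \<Rightarrow> 'a"
  defines "p \<equiv> \<lambda>i j k l. pentagon g 0 (x i) (x i + x j) (x i + x j + x k) (x i + x j + x k + x l)"
  shows pentagon_sharp_shuffle_1_3: "p 1 2 3 4 + p 2 1 3 4 + p 2 3 1 4 + p 2 3 4 1 = 0"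
    and pentagon_sharp_shuffle_2_2:
      "p 1 2 3 4 + p 1 3 2 4 + p 1 3 4 2 + p 3 1 2 4 + p 3 1 4 2 + p 3 4 1 2 = 0"
proof -
  define d where "d k = (if k = 5 then - (x 1 + x 2 + x 3 + x 4) else x k)" for k
  define G where "G i j = - g (- d i) (d j)" for i j
  have G_swap: "G i j = - G j i" if "j < i" for i j
    using odd[of "d i" "- d j"] symmetric[of "d i" "- d j"] unfolding G_def by simp
  have h_G: "h (d i) (d j) = - ((d i + d j) * G i j)" for i j
    by (simp add: h_def G_def flip: reflection)
  have g_G: "g (- d i) (d j) = - G i j" for i j
    by (simp add: G_def)
  define C where "C i j k l = d i * G k l - (d j + d l) * G l j" for i j k l
  have cell: "pentagon_cell g a b c e f = C i j k l"
    if "b - a = d i" "c - b = d j" "e - c = d k" "f - e = d l" for a b c e f i j k l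
  proof -
    have "c - e = - d k" "a - b = - d i"
      by (simp_all flip: that)
    then have "pentagon_cell g a b c e f = h (d l) (d j) - d i * g (- d k) (d l)"
      by (simp add: pentagon_cell_def h_def that)
    then show ?thesis
      by (simp add: h_G g_G C_def algebra_simps)
  qed
  have p: "p i j k l = C i j k l + C j k l 5 + C k l 5 i + C l 5 i j + C 5 i j k"
    if sum: "x i + x j + x k + x l = x 1 + x 2 + x 3 + x 4"
      and "i \<noteq> 5" "j \<noteq> 5" "k \<noteq> 5" "l \<noteq> 5" for i j k l
  proof -
    have d: "d i = x i" "d j = x j" "d k = x k" "d l = x l"
      "d 5 = - (x i + x j + x k + x l)"
      using that by (simp_all add: d_def)
    show ?thesis
      unfolding p_def pentagon_def
      by (intro arg_cong2[where f = "(+)"] cell) (simp_all add: d)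
  qed
  have closed: "d 1 + d 2 + d 3 + d 4 + d 5 = 0"
    by (simp add: d_def algebra_simps)
  have "p 1 2 3 4 + p 2 1 3 4 + p 2 3 1 4 + p 2 3 4 1
      = (d 1 + d 2 + d 3 + d 4 + d 5) * (G 2 3 + G 3 4 + G 4 5 - G 2 5)"
    by (simp add: p C_def G_swap algebra_simps)
  then show "p 1 2 3 4 + p 2 1 3 4 + p 2 3 1 4 + p 2 3 4 1 = 0"
    by (simp add: closed)
  have "p 1 2 3 4 + p 1 3 2 4 + p 1 3 4 2 + p 3 1 2 4 + p 3 1 4 2 + p 3 4 1 2
      = (d 1 + d 2 + d 3 + d 4 + d 5) * (G 1 2 + G 2 5 - G 1 5 + G 3 4 + G 4 5 - G 3 5)"
    by (simp add: p C_def G_swap algebra_simps)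
  then show "p 1 2 3 4 + p 1 3 2 4 + p 1 3 4 2 + p 3 1 2 4 + p 3 1 4 2 + p 3 4 1 2 = 0"
    by (simp add: closed)
qed

lemma g_zero_left: "g 0 v = 0"
proof -
  have double: "a = 0" if "a + a = 0" for a :: 'a
    using that by (metis mult_2 mult_eq_0_iff zero_neq_numeral)
  have "(0 + v) * g (- 0) v - (0 - v) * g 0 v = 0"
    by (simp only: reflection right_minus_eq)
  then have "v * g 0 v + v * g 0 v = 0"
    by simp
  then have "v = 0 \<or> g 0 v = 0"
    by (metis double mult_eq_0_iff)
  moreover have "g 0 0 + g 0 0 = 0"
    using odd[of 0 0] by (metis add.right_inverse minus_zero)
  ultimately show ?thesis
    using double by blast
qed

lemma g_zero_right: "g u 0 = 0"
  by (metis g_zero_left symmetric)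

text \<open>
  Edges \<open>0\<close>, \<open>u\<close>, \<open>- u - v\<close>, \<open>v\<close>, \<open>0\<close>: a term with an edge of length zero vanishes, and only the
  disjoint edges \<open>u\<close> and \<open>v\<close> form a term without such an edge.
\<close>

lemma pentagon_degenerate: "pentagon g 0 0 u (- v) 0 = (v - u) * g v u"
  by (simp add: pentagon_def pentagon_cell_def g_zero_left g_zero_right)

end


section \<open>Period polynomials and their quotients\<close>

text \<open>
  The relations that make sense without a grading. They are linear, so they hold on the whole direct
  sum \<open>S\<close>; on homogeneous polynomials the last one expresses \<open>P(1,0) = 0\<close>.
\<close>

definition period_polys :: "qpoly set" where
  "period_polys = {P \<in> poly_ring {0,1}. P + ev2 P Y X = 0 \<and> ev2 P (- X) Y = P \<and>
     P + ev2 P (X - Y) X + ev2 P (- Y) (X - Y) = 0 \<and> ev2 P X 0 = 0}"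

lemma homogeneous_ev2:
  assumes "homogeneous d p"
  shows "ev2 p (c * a) (c * b) = c ^ d * ev2 p a b"
proof -
  let ?\<sigma> = "(\<lambda>_. 0)(0 := a, 1 := b)"
  have "ev2 p (c * a) (c * b) = subst (\<lambda>i. c * ?\<sigma> i) p"
    unfolding ev2_def by (rule subst_cong[OF poly_ring_UNIV]) auto
  also have "\<dots> = (\<Sum>m\<in>Poly_Mapping.keys p. Const (Poly_Mapping.lookup p m) *
      (c ^ d * (\<Prod>i\<in>Poly_Mapping.keys m. ?\<sigma> i ^ Poly_Mapping.lookup m i)))"
    unfolding subst_def
    by (rule sum.cong)
      (use assms in \<open>auto simp: homogeneous_def power_mult_distrib prod.distrib simp flip: power_sum\<close>)
  also have "\<dots> = c ^ d * ev2 p a b"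
    unfolding ev2_def subst_def sum_distrib_left by (simp add: mult_ac)
  finally show ?thesis .
qed

lemma S2_subset_period_polys: "S2 n \<subseteq> period_polys"
proof
  fix P assume P: "P \<in> S2 n"
  then have "\<forall>s \<in> {1, -1}. \<forall>t \<in> {1, -1}. ev2 P (s * X) (t * Y) = P"
    by (simp add: S2_def)
  then have "ev2 P (- 1 * X) (1 * Y) = P"
    by blast
  moreover have "ev2 P (X * 1) (X * 0) = X ^ (2 * n - 2) * ev2 P 1 0"
    using P by (intro homogeneous_ev2) (simp add: S2_def)
  ultimately show "P \<in> period_polys"
    using P by (simp add: period_polys_def S2_def)
qed

lemma scale_in_poly_ring: "p \<in> poly_ring I \<Longrightarrow> scale c p \<in> poly_ring I"
  by (simp add: scale_def poly_ring_mult)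

lemma ev2_scale: "ev2 (scale c p) a b = scale c (ev2 p a b)"
  by (simp add: scale_def ev2_mult)

lemma subspace_period_polys: "qvs.subspace period_polys"
proof (rule qvs.subspaceI)
  fix p q assume pq: "p \<in> period_polys" "q \<in> period_polys"
  have "(p + q) + (ev2 p Y X + ev2 q Y X) = (p + ev2 p Y X) + (q + ev2 q Y X)"
    "(p + q) + (ev2 p (X - Y) X + ev2 q (X - Y) X) + (ev2 p (- Y) (X - Y) + ev2 q (- Y) (X - Y))
      = (p + ev2 p (X - Y) X + ev2 p (- Y) (X - Y)) + (q + ev2 q (X - Y) X + ev2 q (- Y) (X - Y))"
    by (simp_all add: algebra_simps)
  with pq show "p + q \<in> period_polys"
    unfolding period_polys_def mem_Collect_eq ev2_add
    by (auto simp only: poly_ring_add add_0_left)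
next
  fix c p assume p: "p \<in> period_polys"
  have "scale c p + scale c (ev2 p Y X) = scale c (p + ev2 p Y X)"
    "scale c p + scale c (ev2 p (X - Y) X) + scale c (ev2 p (- Y) (X - Y))
      = scale c (p + ev2 p (X - Y) X + ev2 p (- Y) (X - Y))"
    by (simp_all add: scale_def algebra_simps)
  with p show "scale c p \<in> period_polys"
    unfolding period_polys_def mem_Collect_eq ev2_scale
    by (auto simp only: scale_in_poly_ring qvs.scale_zero_right)
qed (simp add: period_polys_def)

lemma homogeneous_add: "homogeneous d p \<Longrightarrow> homogeneous d q \<Longrightarrow> homogeneous d (p + q)"
  unfolding homogeneous_def using keys_add[of p q] by blast

lemma homogeneous_scale: "homogeneous d p \<Longrightarrow> homogeneous d (scale c p)"
  unfolding homogeneous_def scale_def Const_def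
  using keys_mult[of "Poly_Mapping.single 0 c" p] by (fastforce split: if_splits)

lemma subspace_S2: "qvs.subspace (S2 n)"
proof (rule qvs.subspaceI)
  show "0 \<in> S2 n"
    by (simp add: S2_def homogeneous_def)
next
  fix p q assume pq: "p \<in> S2 n" "q \<in> S2 n"
  then have "p + q \<in> period_polys"
    using S2_subset_period_polys qvs.subspace_add[OF subspace_period_polys] by blast
  with pq show "p + q \<in> S2 n"
    by (simp add: S2_def period_polys_def homogeneous_add ev2_add)
next
  fix c p assume p: "p \<in> S2 n"
  then have "scale c p \<in> period_polys"
    using S2_subset_period_polys qvs.subspace_scale[OF subspace_period_polys] by blast
  with p show "scale c p \<in> S2 n"
    by (simp add: S2_def period_polys_def homogeneous_scale ev2_scale)
qed

lemma S_subset_period_polys: "S \<subseteq> period_polys"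
proof
  fix f assume "f \<in> S"
  then obtain N P where "f = (\<Sum>n\<in>N. P n)" "\<forall>n\<in>N. P n \<in> S2 n"
    by (auto simp: S_def)
  then show "f \<in> period_polys"
    using S2_subset_period_polys by (auto intro!: qvs.subspace_sum[OF subspace_period_polys])
qed

lemma subspace_S: "qvs.subspace S"
proof (rule qvs.subspaceI)
  show "0 \<in> S"
    unfolding S_def by (intro CollectI exI[of _ "{}"]) auto
next
  fix f g assume "f \<in> S" "g \<in> S"
  then obtain N P M Q where f: "f = (\<Sum>n\<in>N. P n)" "finite N" "N \<subseteq> {1..}" "\<forall>n\<in>N. P n \<in> S2 n"
    and g: "g = (\<Sum>n\<in>M. Q n)" "finite M" "M \<subseteq> {1..}" "\<forall>n\<in>M. Q n \<in> S2 n"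
    unfolding S_def by blast
  let ?R = "\<lambda>n. (if n \<in> N then P n else 0) + (if n \<in> M then Q n else 0)"
  have "f + g = (\<Sum>n\<in>N \<union> M. ?R n)"
    using f(1,2) g(1,2) by (simp add: sum.distrib sum.If_cases Int_absorb1 Int_absorb2)
  moreover have "?R n \<in> S2 n" for n
    using f(4) g(4) qvs.subspace_0[OF subspace_S2]
    by (intro qvs.subspace_add[OF subspace_S2]) auto
  ultimately show "f + g \<in> S"
    unfolding S_def using f(2,3) g(2,3)
    by (intro CollectI exI[of _ "N \<union> M"] exI[of _ ?R]) auto
next
  fix c f assume "f \<in> S"
  then obtain N P where f: "f = (\<Sum>n\<in>N. P n)" "finite N" "N \<subseteq> {1..}" "\<forall>n\<in>N. P n \<in> S2 n"
    unfolding S_def by blast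
  then have "scale c f = (\<Sum>n\<in>N. scale c (P n))"
    by (simp add: qvs.scale_sum_right)
  then show "scale c f \<in> S"
    unfolding S_def using f(2-4) qvs.subspace_scale[OF subspace_S2]
    by (intro CollectI exI[of _ N] exI[of _ "\<lambda>n. scale c (P n)"]) auto
qed

text \<open>
  A period polynomial vanishes on the lines \<open>y = 0\<close> by definition, \<open>x = 0\<close> and \<open>x = y\<close> by
  antisymmetry. The three linear factors are split off one after the other.
\<close>

lemma f0_exists:
  assumes P: "P \<in> period_polys"
  obtains g where "g \<in> poly_ring {0,1}" "P = X * Y * (X - Y) * g"
proof -
  have ring: "X \<in> poly_ring {0,1}" "Y \<in> poly_ring {0,1}"
    by (simp_all add: poly_ring_Var)
  have anti: "ev2 P a b + ev2 P b a = 0" for a b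
  proof -
    have "ev2 (P + ev2 P Y X) a b = 0"
      using P by (simp add: period_polys_def)
    then show ?thesis
      by (simp add: ev2_add ev2_ev2)
  qed
  have at_Y_zero: "ev2 P X 0 = 0"
    using P by (simp add: period_polys_def)
  have "ev2 (ev2 P X 0) Y 0 = 0"
    by (simp add: at_Y_zero)
  then have "ev2 P 0 Y = 0"
    using anti[of 0 Y] by (simp add: ev2_ev2)
  then obtain q where q: "q \<in> poly_ring {0,1}" "P = X * q"
    using P ring by (auto simp: period_polys_def elim: linear_factor[of P X 0 Y])
  have "ev2 q X 0 = 0"
    using at_Y_zero X_nonzero by (simp add: q(2) ev2_mult)
  then obtain r where r: "r \<in> poly_ring {0,1}" "q = Y * r"
    using q(1) ring by (auto elim: linear_factor[of q Y X 0])
  have "2 * ev2 P X X = 0"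
    using anti[of X X] by (simp only: mult_2)
  then have "ev2 r X X = 0"
    using X_nonzero by (simp add: q(2) r(2) ev2_mult)
  moreover have "X - Y dvd Y - X"
    using dvd_minus_iff[of "X - Y" "X - Y"] by simp
  ultimately obtain g where "g \<in> poly_ring {0,1}" "r = (X - Y) * g"
    using r(1) ring by (auto elim: linear_factor[of r "X - Y" X X] simp: poly_ring_diff)
  then show ?thesis
    using that q(2) r(2) by (simp add: mult_ac)
qed

lemma f0_in_poly_ring: "P \<in> period_polys \<Longrightarrow> f0 P \<in> poly_ring {0,1}"
  and f0_factor: "P \<in> period_polys \<Longrightarrow> P = X * Y * (X - Y) * f0 P"
  using f0_exists f0_eqI by metis+

lemma f0_add:
  assumes "P \<in> period_polys" "Q \<in> period_polys"
  shows "f0 (P + Q) = f0 P + f0 Q"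
proof (rule f0_eqI)
  show "P + Q = X * Y * (X - Y) * (f0 P + f0 Q)"
    using f0_factor[OF assms(1)] f0_factor[OF assms(2)] by (metis distrib_left)
qed (use assms in \<open>simp add: f0_in_poly_ring poly_ring_add\<close>)

lemma f0_scale:
  assumes "P \<in> period_polys"
  shows "f0 (scale c P) = scale c (f0 P)"
proof (rule f0_eqI)
  have "scale c P = scale c (X * Y * (X - Y) * f0 P)"
    using f0_factor[OF assms] by simp
  then show "scale c P = X * Y * (X - Y) * scale c (f0 P)"
    by (simp add: scale_def mult_ac)
qed (use assms in \<open>simp add: f0_in_poly_ring scale_in_poly_ring\<close>)

text \<open>
  The identities are proved at the generic point \<open>(X, Y)\<close>, where the denominator \<open>X * Y * (X - Y)\<close> is
  nonzero and can be cancelled, and then transported to all arguments by substitution.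
\<close>

lemma period_function_f0:
  assumes P: "P \<in> period_polys"
  shows "period_function (ev2 (f0 P))"
proof -
  define g where "g = f0 P"
  have gXY: "ev2 g X Y = g"
    using f0_in_poly_ring[OF P] by (simp add: g_def ev2_X_Y)
  have P_eq: "ev2 P a b = a * b * (a - b) * ev2 g a b" for a b
  proof -
    have "ev2 P a b = ev2 (X * Y * (X - Y) * g) a b"
      using f0_factor[OF P] by (simp add: g_def)
    then show ?thesis
      by (simp add: ev2_ring)
  qed
  have PXY: "P = X * Y * (X - Y) * g"
    using f0_factor[OF P] by (simp add: g_def)
  note nonzero = X_nonzero Y_nonzero X_minus_Y_nonzero
  have cancel: "u = v" if "X * Y * (X - Y) * u = X * Y * (X - Y) * v" for u v
    using that nonzero by simp
  have swap: "P = - ev2 P Y X" and minus: "ev2 P (- X) Y = P"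
    and period: "P + ev2 P (X - Y) X + ev2 P (- Y) (X - Y) = 0"
    using P by (simp_all add: period_polys_def eq_neg_iff_add_eq_0)
  have sym_XY: "ev2 g Y X = g"
  proof (rule cancel)
    have "X * Y * (X - Y) * ev2 g Y X = - ev2 P Y X"
      unfolding P_eq by (simp add: algebra_simps)
    then show "X * Y * (X - Y) * ev2 g Y X = X * Y * (X - Y) * g"
      using swap PXY by metis
  qed
  have refl_XY: "(X + Y) * ev2 g (- X) Y = (X - Y) * g"
  proof -
    have "X * Y * ((X + Y) * ev2 g (- X) Y) = ev2 P (- X) Y"
      unfolding P_eq by (simp add: algebra_simps)
    also have "\<dots> = X * Y * ((X - Y) * g)"
      unfolding minus PXY[symmetric] using PXY by (simp add: mult_ac)
    finally show ?thesis
      using nonzero by simp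
  qed
  (* The sign change of the second variable is the one of the first, conjugated by the swap. *)
  have odd_XY: "ev2 g (- X) (- Y) = - g"
  proof (rule cancel)
    have "ev2 P (- X) (- Y) = ev2 (ev2 P (- X) Y) X (- Y)"
      by (simp add: ev2_ev2 ev2_uminus)
    also have "\<dots> = - ev2 (ev2 P Y X) X (- Y)"
      unfolding minus by (subst swap) (rule ev2_uminus)
    also have "\<dots> = - ev2 (ev2 P (- X) Y) Y X"
      by (simp add: ev2_ev2 ev2_uminus)
    also have "\<dots> = P"
      unfolding minus by (rule swap[symmetric])
    finally have "X * Y * (X - Y) * ev2 g (- X) (- Y) = - P"
      unfolding P_eq by (simp add: algebra_simps)
    then show "X * Y * (X - Y) * ev2 g (- X) (- Y) = X * Y * (X - Y) * - g"
      by (simp add: PXY)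
  qed
  have period_XY: "g - ev2 g (X - Y) X + ev2 g (- Y) (X - Y) = 0"
  proof (rule cancel)
    have "X * Y * (X - Y) * (g - ev2 g (X - Y) X + ev2 g (- Y) (X - Y))
        = P + ev2 P (X - Y) X + ev2 P (- Y) (X - Y)"
      unfolding P_eq by (subst PXY) (simp add: algebra_simps)
    then show "X * Y * (X - Y) * (g - ev2 g (X - Y) X + ev2 g (- Y) (X - Y)) = X * Y * (X - Y) * 0"
      by (simp only: period mult_zero_right)
  qed
  have "period_function (ev2 g)"
  proof
    fix u v
    show "ev2 g v u = ev2 g u v"
      using arg_cong[OF sym_XY, of "\<lambda>p. ev2 p u v"] by (simp add: ev2_ev2 ev2_ring)
    show "ev2 g (- u) (- v) = - ev2 g u v"
      using arg_cong[OF odd_XY, of "\<lambda>p. ev2 p u v"] by (simp add: ev2_ev2 ev2_ring)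
    show "(u + v) * ev2 g (- u) v = (u - v) * ev2 g u v"
      using arg_cong[OF refl_XY, of "\<lambda>p. ev2 p u v"] by (simp add: ev2_ev2 ev2_ring)
    show "ev2 g u v - ev2 g (u - v) u + ev2 g (- v) (u - v) = 0"
      using arg_cong[OF period_XY, of "\<lambda>p. ev2 p u v"] by (simp add: ev2_ev2 ev2_ring)
  qed
  then show ?thesis
    by (simp add: g_def)
qed


section \<open>Exceptional polynomials as pentagon sums\<close>

lemma subst_exc:
  "subst \<sigma> (exc f) = pentagon (ev2 (f0 f)) (\<sigma> 0) (\<sigma> 1) (\<sigma> 2) (\<sigma> 3) (\<sigma> 4)"
proof -
  have five: "{..<5} = {0, 1, 2, 3, 4::nat}"
    by auto
  show ?thesis
    by (simp add: exc_def five Let_def subst_ev2 pentagon_def pentagon_cell_def f1_def ev2_ring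
        add.assoc)
      (simp add: One_nat_def numeral_2_eq_2)
qed

lemma ev4_exc_bar: "ev4 (exc_bar f) a b c d = pentagon (ev2 (f0 f)) 0 a b c d"
  unfolding ev4_def exc_bar_def subst_subst unfolding subst_exc by simp

lemma exc_bar_in_poly_ring: "exc_bar f \<in> poly_ring {1..4}"
  unfolding exc_bar_def subst_exc pentagon_def pentagon_cell_def
  by (intro poly_ring_add poly_ring_mult poly_ring_diff ev2_in_poly_ring) (auto simp: poly_ring_Var)

lemma exc_bar_add:
  assumes "f \<in> period_polys" "g \<in> period_polys"
  shows "exc_bar (f + g) = exc_bar f + exc_bar g"
  unfolding exc_bar_def subst_exc pentagon_def pentagon_cell_def
  by (simp add: f0_add[OF assms] ev2_add algebra_simps)

lemma exc_bar_scale: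
  assumes "f \<in> period_polys"
  shows "exc_bar (scale c f) = scale c (exc_bar f)"
  unfolding exc_bar_def subst_exc pentagon_def pentagon_cell_def
  by (simp add: f0_scale[OF assms] ev2_scale) (simp add: scale_def algebra_simps)

lemma exc_bar_in_D4:
  assumes "f \<in> period_polys"
  shows "exc_bar f \<in> D4"
proof -
  interpret period_function "ev2 (f0 f)"
    by (rule period_function_f0[OF assms])
  (* The first vertex of the pentagon is the base point 0. *)
  define y where "y i = (if i = 0 then 0 else Var i)" for i
  show ?thesis
    unfolding D4_def
    using exc_bar_in_poly_ring[of f]
      pentagon_shuffle_1_3[of y] pentagon_shuffle_2_2[of y]
      pentagon_sharp_shuffle_1_3[of Var] pentagon_sharp_shuffle_2_2[of Var]
    by (simp add: y_def shA_def shB_def ev4_exc_bar add.assoc)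
qed

lemma subspace_D4: "qvs.subspace D4"
proof (rule qvs.subspaceI)
  have "word 0 w = 0" "word_sharp 0 w = 0" for w
    by (cases w; simp add: ev4_def)+
  then show "0 \<in> D4"
    by (simp add: D4_def)
next
  fix f g assume fg: "f \<in> D4" "g \<in> D4"
  have "word (f + g) w = word f w + word g w"
    "word_sharp (f + g) w = word_sharp f w + word_sharp g w" for w
    by (cases w; simp add: ev4_def)+
  with fg show "f + g \<in> D4"
    by (simp add: D4_def poly_ring_add sum.distrib)
next
  fix c f assume f: "f \<in> D4"
  have "word (scale c f) w = Const c * word f w"
    "word_sharp (scale c f) w = Const c * word_sharp f w" for w
    by (cases w; simp add: ev4_def scale_def)+
  with f show "scale c f \<in> D4"
    by (simp add: D4_def scale_in_poly_ring flip: sum_distrib_left)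
qed

text \<open>
  The substitution \<open>(0, X, - Y, 0)\<close> recovers \<open>(Y - X) * f0 f\<close>, with the variables of \<open>f0 f\<close>
  exchanged, from \<open>exc_bar f\<close>.
\<close>

lemma exc_bar_kernel:
  assumes "f \<in> period_polys" "exc_bar f = 0"
  shows "f = 0"
proof -
  interpret period_function "ev2 (f0 f)"
    by (rule period_function_f0[OF assms(1)])
  have "(Y - X) * ev2 (f0 f) Y X = ev4 (exc_bar f) 0 X (- Y) 0"
    by (simp add: ev4_exc_bar pentagon_degenerate)
  also have "\<dots> = 0"
    by (simp add: assms(2) ev4_def)
  finally have "ev2 (f0 f) Y X = 0"
    using X_minus_Y_nonzero by simp
  then have "f0 f = 0"
    using symmetric[of X Y] ev2_X_Y[OF f0_in_poly_ring[OF assms(1)]] by simp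
  then show ?thesis
    using f0_factor[OF assms(1)] by simp
qed

theorem theorem1p2:
  shows "(\<forall>f \<in> S. exc_bar f \<in> D4) \<and>
    qvs.subspace S \<and> qvs.subspace D4 \<and>
    (\<forall>f \<in> S. \<forall>g \<in> S. exc_bar (f + g) = exc_bar f + exc_bar g) \<and>
    (\<forall>c. \<forall>f \<in> S. exc_bar (scale c f) = scale c (exc_bar f)) \<and>
    inj_on exc_bar S"
proof -
  have inj: "f = g" if "f \<in> S" "g \<in> S" "exc_bar f = exc_bar g" for f g
  proof -
    have "f - g \<in> S"
      by (rule qvs.subspace_diff[OF subspace_S that(1,2)])
    then have in_polys: "f - g \<in> period_polys" "g \<in> period_polys"
      using that(2) S_subset_period_polys by blast+
    have "exc_bar (f - g) + exc_bar g = exc_bar f"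
      using exc_bar_add[OF in_polys] by simp
    then have "f - g = 0"
      using that(3) by (intro exc_bar_kernel[OF in_polys(1)]) simp
    then show ?thesis
      by simp
  qed
  have "f \<in> period_polys" if "f \<in> S" for f
    using that S_subset_period_polys by blast
  then show ?thesis
    by (simp add: exc_bar_in_D4 exc_bar_add exc_bar_scale subspace_S subspace_D4 inj_onI inj)
qed

end
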